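(* Let $\Phi$ be a (non-empty) set of target functions such that $0 \le \alpha(\Phi) < 1$. Then $\Phi$ is compatible with respect to the convergence problem.
   Context: Robot model. Robots $r_1,\dots,r_n$ are points in the plane $\mathbb{R}^2$, which carries a fixed right-handed global coordinate system $Z_0$. Time is discrete, $t=0,1,2,\dots$; $\mathbf{x}_t(r_i)$ is the position of $r_i$ at time $t$ in $Z_0$, and the configuration at $t$ is the multiset $P_t=\{\mathbf{x}_t(r_i):1\le i\le n\}$. Robot $r_i$ has a local coordinate system $Z_i$, right-handed, with its own unit length and axis directions (arbitrary, fixed over time), whose origin is always the current position of $r_i$; $\gamma_i$ denotes the coordinate transformation from $Z_i$ to $Z_0$ (an orientation-preserving similarity with $\gamma_i((0,0))=\mathbf{x}_t(r_i)$ at time $t$). A target function $\phi$ assigns to every multiset $P$ of $n$ points of $\mathbb{R}^2$ (for every $n\ge1$) an element of $\mathbb{R}^2\cup\{\bot\}$, with $\phi(P)=\bot$ if and only if $(0,0)\notin P$. Each robot $r_i$ is assigned a target function $\phi_i$. The scheduler is semi-synchronous: at each time $t$ an arbitrary subset of robots is activated; if $r_i$ is activated at $t$ then $\mathbf{x}_{t+1}(r_i)=\gamma_i(\phi_i(\gamma_i^{-1}(P_t)))$, otherwise $\mathbf{x}_{t+1}(r_i)=\mathbf{x}_t(r_i)$. The schedule is fair: every robot is activated infinitely often. The resulting sequence $P_0,P_1,\dots$ is an execution. Scale. $CH(P)$ is the convex hull of $P$, $g(P)=\frac1n\sum_{\mathbf{x}\in P}\mathbf{x}$ (with multiplicity),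 and $d*CH(P)=\{d\mathbf{x}+(1-d)g(P):\mathbf{x}\in CH(P)\}$ for $d\ge0$. $\alpha(\phi,P)$ is the smallest $d\ge 0$ with $\phi(P)\in d*CH(P)$ (and $0$ if $\phi(P)=\bot$; $\infty$ if there is no such $d$). $\alpha(\phi)=\sup_P\alpha(\phi,P)$ and $\alpha(\Phi)=\sup_{\phi\in\Phi}\alpha(\phi)$. Compatibility. $\Phi$ is compatible with respect to a problem if, for every number $n$ of robots, every assignment of target functions from $\Phi$ to the robots (different robots may get different ones), every choice of local coordinate systems, every initial configuration and every fair schedule, the execution satisfies the requirement of the problem. The convergence problem (no faults) requires that all robots converge to one common point as $t\to\infty$. *)

theory Defs
  imports "HOL-Analysis.Analysis" "HOL-Library.Multiset"
begin

type_synonym point = "real^2"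

subsection \<open>Target functions and their scale\<close>

text \<open>\<^term>\<open>None\<close> plays the role of the undefined value \<open>\<bottom>\<close>. The empty multiset is not a
  configuration, so the value there is left unconstrained and is ignored everywhere below.\<close>

type_synonym target = "point multiset \<Rightarrow> point option"

definition target_function :: "target \<Rightarrow> bool" where
  "target_function \<phi> \<longleftrightarrow> (\<forall>P. P \<noteq> {#} \<longrightarrow> (\<phi> P = None \<longleftrightarrow> 0 \<notin># P))"

definition centroid :: "point multiset \<Rightarrow> point" where
  "centroid P = (1 / real (size P)) *\<^sub>R (\<Sum>x\<in>#P. x)"

definition scaled_hull :: "real \<Rightarrow> point multiset \<Rightarrow> point set" where
  "scaled_hull d P = {d *\<^sub>R x + (1 - d) *\<^sub>R centroid P | x. x \<in> convex hull (set_mset P)}"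

text \<open>The infimum of the empty set in \<^typ>\<open>ereal\<close> is \<open>\<infinity>\<close>; lemma \<open>scale_at_attained\<close> below shows
  that otherwise the infimum is a minimum.\<close>

definition scale_at :: "target \<Rightarrow> point multiset \<Rightarrow> ereal" where
  "scale_at \<phi> P = (case \<phi> P of
      None \<Rightarrow> 0
    | Some y \<Rightarrow> Inf {ereal d | d. 0 \<le> d \<and> y \<in> scaled_hull d P})"

definition scale :: "target \<Rightarrow> ereal" where
  "scale \<phi> = (SUP P\<in>{P. P \<noteq> {#}}. scale_at \<phi> P)"

definition scale_set :: "target set \<Rightarrow> ereal" where
  "scale_set \<Phi> = (SUP \<phi>\<in>\<Phi>. scale \<phi>)"

lemma scale_at_attained:
  assumes "\<phi> P = Some y" "0 \<le> d0" "y \<in> scaled_hull d0 P"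
  shows "\<exists>d. 0 \<le> d \<and> y \<in> scaled_hull d P \<and> scale_at \<phi> P = ereal d"
proof -
  let ?D = "{d. 0 \<le> d \<and> y \<in> scaled_hull d P}"
  let ?f = "\<lambda>z :: real \<times> point. fst z *\<^sub>R snd z + (1 - fst z) *\<^sub>R centroid P"
  let ?K = "{0..d0} \<times> (convex hull (set_mset P))"
  have "compact (convex hull (set_mset P))"
    by (simp add: finite_imp_compact_convex_hull)
  then have "compact ?K"
    by (intro compact_Times) auto
  moreover have "closed (?f -` {y})"
    by (intro closed_vimage continuous_intros)
  ultimately have "compact (fst ` (?K \<inter> ?f -` {y}))"
    by (intro compact_continuous_image compact_Int_closed continuous_intros)
  moreover have "fst ` (?K \<inter> ?f -` {y}) = ?D \<inter> {..d0}"
  proof (intro equalityI subsetI)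
    fix d assume "d \<in> fst ` (?K \<inter> ?f -` {y})"
    then show "d \<in> ?D \<inter> {..d0}"
      by (auto simp: scaled_hull_def)
  next
    fix d assume d: "d \<in> ?D \<inter> {..d0}"
    then obtain x where "x \<in> convex hull (set_mset P)"
      "y = d *\<^sub>R x + (1 - d) *\<^sub>R centroid P"
      by (auto simp: scaled_hull_def)
    with d have "(d, x) \<in> ?K \<inter> ?f -` {y}"
      by simp
    then show "d \<in> fst ` (?K \<inter> ?f -` {y})"
      by (rule image_eqI[rotated]) simp
  qed
  ultimately have "compact (?D \<inter> {..d0})"
    by (simp only:)
  moreover have "?D \<inter> {..d0} \<noteq> {}"
    using assms by auto
  ultimately have "\<exists>m\<in>?D \<inter> {..d0}. \<forall>t\<in>?D \<inter> {..d0}. m \<le> t"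
    by (rule compact_attains_inf)
  then obtain m where m: "m \<in> ?D \<inter> {..d0}" "\<forall>t\<in>?D \<inter> {..d0}. m \<le> t"
    by (elim bexE)
  have "Inf {ereal d | d. 0 \<le> d \<and> y \<in> scaled_hull d P} = ereal m"
  proof (rule antisym)
    show "Inf {ereal d | d. 0 \<le> d \<and> y \<in> scaled_hull d P} \<le> ereal m"
      using m(1) by (intro Inf_lower) auto
    show "ereal m \<le> Inf {ereal d | d. 0 \<le> d \<and> y \<in> scaled_hull d P}"
    proof (rule Inf_greatest)
      fix e assume "e \<in> {ereal d | d. 0 \<le> d \<and> y \<in> scaled_hull d P}"
      then obtain d where d: "e = ereal d" "d \<in> ?D" by auto
      show "ereal m \<le> e"
        using m d by (cases "d \<le> d0") auto
    qed
  qed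
  then show ?thesis
    using m(1) assms(1) by (auto simp: scale_at_def)
qed

subsection \<open>Robots and executions\<close>

text \<open>A local coordinate system consists of a unit length \<open>u > 0\<close>, a rotation matrix \<open>R\<close> giving the
  axis directions (determinant 1, hence right-handed), and its origin \<open>p\<close>. The transformation from
  local to global coordinates is then the following orientation-preserving similarity.\<close>

definition local_to_global :: "real \<Rightarrow> real^2^2 \<Rightarrow> point \<Rightarrow> point \<Rightarrow> point" where
  "local_to_global u R p v = p + u *\<^sub>R (R *v v)"

text \<open>The robots are \<open>0, \<dots>, n - 1\<close>, and \<open>x t i\<close> is the global position of robot \<open>i\<close> at time \<open>t\<close>.\<close>

type_synonym trajectory = "nat \<Rightarrow> nat \<Rightarrow> point"

definition configuration :: "nat \<Rightarrow> trajectory \<Rightarrow> nat \<Rightarrow> point multiset" where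
  "configuration n x t = image_mset (x t) (mset_set {..<n})"

definition fair_schedule :: "nat \<Rightarrow> (nat \<Rightarrow> nat set) \<Rightarrow> bool" where
  "fair_schedule n S \<longleftrightarrow> (\<forall>t. S t \<subseteq> {..<n}) \<and> (\<forall>i<n. \<exists>\<^sub>\<infinity>t. i \<in> S t)"

definition execution ::
  "nat \<Rightarrow> (nat \<Rightarrow> target) \<Rightarrow> (nat \<Rightarrow> real) \<Rightarrow> (nat \<Rightarrow> real^2^2) \<Rightarrow> (nat \<Rightarrow> nat set) \<Rightarrow> trajectory \<Rightarrow> bool"
where
  "execution n \<phi> u R S x \<longleftrightarrow>
    (\<forall>t. \<forall>i<n.
      let \<gamma> = local_to_global (u i) (R i) (x t i) in
      if i \<in> S t
      then map_option \<gamma> (\<phi> i (image_mset (inv \<gamma>) (configuration n x t))) = Some (x (Suc t) i)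
      else x (Suc t) i = x t i)"

text \<open>An activated robot always sees itself at the origin, so \<open>None\<close> never arises and every
  initial configuration gives rise to an execution.\<close>

lemma execution_exists:
  assumes "\<And>i. i < n \<Longrightarrow> target_function (\<phi> i)"
    and "\<And>i. i < n \<Longrightarrow> 0 < u i \<and> rotation_matrix (R i)"
  shows "\<exists>x. x 0 = x0 \<and> execution n \<phi> u R S x"
proof -
  define conf where "conf p = image_mset p (mset_set {..<n})" for p :: "nat \<Rightarrow> point"
  define G where "G p i = local_to_global (u i) (R i) (p i)" for p i
  define step where "step t p i =
      (if i \<in> S t then the (map_option (G p i) (\<phi> i (image_mset (inv (G p i)) (conf p)))) else p i)"
    for t p i
  define x where "x = rec_nat x0 step"
  have x: "x 0 = x0" "x (Suc t) = step t (x t)" for t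
    by (simp_all add: x_def)
  have some: "\<phi> i (image_mset (inv (G p i)) (conf p)) \<noteq> None" if i: "i < n" for p i
  proof -
    have "orthogonal_matrix (R i)"
      using assms(2)[OF i] by (simp add: rotation_matrix_def)
    then have "inj ((*v) (R i))"
      by (metis inj_matrix_vector_mult invertible_def orthogonal_matrix_def)
    then have "inj (G p i)"
      using assms(2)[OF i] by (auto simp: inj_def G_def local_to_global_def)
    moreover have "G p i 0 = p i"
      by (simp add: G_def local_to_global_def)
    ultimately have "inv (G p i) (p i) = 0"
      by (metis inv_f_f)
    then have "0 \<in># image_mset (inv (G p i)) (conf p)"
      using i by (force simp: conf_def)
    then show ?thesis
      using assms(1)[OF i] unfolding target_function_def
      by (metis empty_not_add_mset multi_member_split)
  qed
  have "map_option (G (x t) i) (\<phi> i (image_mset (inv (G (x t) i)) (conf (x t)))) = Some (x (Suc t) i)"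
    if "i < n" "i \<in> S t" for i t
    using some[OF that(1), of "x t"] that(2) unfolding x(2) step_def by force
  moreover have "x (Suc t) i = x t i" if "i \<notin> S t" for i t
    using that by (simp add: x(2) step_def)
  ultimately have "execution n \<phi> u R S x"
    unfolding execution_def Let_def configuration_def G_def conf_def by presburger
  then show ?thesis
    using x(1) by blast
qed

subsection \<open>Compatibility\<close>

text \<open>A problem is given by its requirement on the number of robots and their trajectories. Since a
  trajectory contains its initial positions \<open>x 0\<close>, quantifying over all executions \<open>x\<close>
  includes quantifying over all initial configurations.\<close>

type_synonym problem = "nat \<Rightarrow> trajectory \<Rightarrow> bool"

definition compatible :: "target set \<Rightarrow> problem \<Rightarrow> bool" where
  "compatible \<Phi> Q \<longleftrightarrow>
    (\<forall>n \<phi> u R S x.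
      1 \<le> n \<longrightarrow>
      (\<forall>i<n. \<phi> i \<in> \<Phi>) \<longrightarrow>
      (\<forall>i<n. 0 < u i \<and> rotation_matrix (R i)) \<longrightarrow>
      fair_schedule n S \<longrightarrow>
      execution n \<phi> u R S x \<longrightarrow>
      Q n x)"

definition convergence :: problem where
  "convergence n x \<longleftrightarrow> (\<exists>p. \<forall>i<n. (\<lambda>t. x t i) \<longlonglongrightarrow> p)"

end

theory Submission
  imports Defs
begin

text \<open>Look at one coordinate of the robots, with maximum \<open>M t\<close> and minimum \<open>m t\<close> over the
  configuration at time \<open>t\<close>. If all scales are below some \<open>b < 1\<close>, an activated robot is pulled towards the
  centroid, so it moves into the interval from \<open>m t\<close> to \<open>M t - (1 - b) * (M t - m t) / n\<close>. Hence \<open>M\<close> decreases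
  to a limit \<open>A\<close> and \<open>m\<close> increases to a limit \<open>B\<close>. Were \<open>B < A\<close>, then as soon as \<open>M\<close> is close enough
  to \<open>A\<close>, every activation would put the robot below \<open>A\<close> by a fixed amount; once fairness has
  activated all robots, \<open>M\<close> would be below its limit.\<close>

lemma contracting_updates_converge:
  fixes f :: "nat \<Rightarrow> nat \<Rightarrow> real"
  assumes n: "1 \<le> n" and c: "0 < c"
    and fair: "\<And>i. i < n \<Longrightarrow> \<exists>\<^sub>\<infinity>t. i \<in> S t"
    and idle: "\<And>t i. i < n \<Longrightarrow> i \<notin> S t \<Longrightarrow> f (Suc t) i = f t i"
    and lower: "\<And>t i. i < n \<Longrightarrow> i \<in> S t \<Longrightarrow> Min (f t ` {..<n}) \<le> f (Suc t) i"
    and upper: "\<And>t i. i < n \<Longrightarrow> i \<in> S t \<Longrightarrow>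
      f (Suc t) i \<le> Max (f t ` {..<n}) - c * (Max (f t ` {..<n}) - Min (f t ` {..<n}))"
  shows "\<exists>l. \<forall>i<n. (\<lambda>t. f t i) \<longlonglongrightarrow> l"
proof -
  define M where "M t = Max (f t ` {..<n})" for t
  define m where "m t = Min (f t ` {..<n})" for t
  have ne: "{..<n} \<noteq> {}" using n by (auto simp: lessThan_empty_iff)
  have le_M: "f t i \<le> M t" and m_le: "m t \<le> f t i" if "i < n" for t i
    using that by (auto simp: M_def m_def)
  have M_leI: "M t \<le> z" if "\<And>i. i < n \<Longrightarrow> f t i \<le> z" for t z
    using that ne by (auto simp: M_def)
  have m_geI: "z \<le> m t" if "\<And>i. i < n \<Longrightarrow> z \<le> f t i" for t z
    using that ne by (auto simp: m_def)
  have m_M: "m t \<le> M t" for t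
    using le_M[of 0 t] m_le[of 0 t] n by linarith
  have up: "f (Suc t) i \<le> M t - c * (M t - m t)" if "i < n" "i \<in> S t" for t i
    using upper[OF that] by (simp add: M_def m_def)
  have M_Suc: "M (Suc t) \<le> M t" for t
  proof (rule M_leI)
    fix i assume i: "i < n"
    have "0 \<le> c * (M t - m t)" using c m_M[of t] by simp
    then show "f (Suc t) i \<le> M t"
      using up[of i t] idle[of i t] le_M[of i t] i by (cases "i \<in> S t") auto
  qed
  have m_Suc: "m t \<le> m (Suc t)" for t
  proof (rule m_geI)
    fix i assume i: "i < n"
    then show "m t \<le> f (Suc t) i"
      using lower[of i t] idle[of i t] m_le[of i t] by (cases "i \<in> S t") (auto simp: m_def)
  qed
  have dec: "decseq M" and inc: "incseq m"
    using M_Suc m_Suc by (auto intro: decseq_SucI incseq_SucI)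
  have "m 0 \<le> M t" "m t \<le> M 0" for t
    using m_M[of t] incseqD[OF inc, of 0 t] decseqD[OF dec, of 0 t] by auto
  then obtain A B where A: "M \<longlonglongrightarrow> A" "\<And>t. A \<le> M t" and B: "m \<longlonglongrightarrow> B" "\<And>t. m t \<le> B"
    using decseq_convergent[OF dec] incseq_convergent[OF inc] by metis
  have "B \<le> A" using LIMSEQ_le[OF B(1) A(1)] m_M by blast
  have "A = B"
  proof (rule ccontr)
    \<comment> \<open>The gap \<open>M t - m t\<close> never falls below \<open>A - B\<close>, so
      every activation puts the robot at least \<open>e\<close> below the current maximum. Once that
      maximum is within \<open>e / 2\<close> of \<open>A\<close>, the robot lands at or below
      \<open>A - e / 2\<close>.\<close>
    define e where "e = c * (A - B)"
    assume "A \<noteq> B"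
    with \<open>B \<le> A\<close> c have "e > 0" by (simp add: e_def)
    then have "\<forall>\<^sub>F t in sequentially. M t < A + e / 2"
      using order_tendstoD(2)[OF A(1), of "A + e / 2"] by simp
    then obtain T where T: "\<And>t. T \<le> t \<Longrightarrow> M t < A + e / 2"
      by (auto simp: eventually_sequentially)
    have act: "f (Suc t) i \<le> A - e / 2" if "i < n" "i \<in> S t" "T \<le> t" for t i
    proof -
      have "A - B \<le> M t - m t" using A(2)[of t] B(2)[of t] by linarith
      then have "e \<le> c * (M t - m t)" unfolding e_def using c by simp
      then show ?thesis using up[OF that(1,2)] T[OF that(3)] by linarith
    qed
    have "\<exists>t\<ge>T. i \<in> S t" if "i < n" for i
      using fair[OF that] by (auto simp: INFM_nat_le)
    then obtain a where a: "\<And>i. i < n \<Longrightarrow> T \<le> a i \<and> i \<in> S (a i)" by metis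
    \<comment> \<open>All the activations chosen above have happened by time \<open>U\<close>; they
      show in the positions one step later, hence \<open>Suc U\<close> below.\<close>
    define U where "U = Max (a ` {..<n})"
    have "f (Suc U) i \<le> A - e / 2" if i: "i < n" for i
    proof -
      \<comment> \<open>The bound persists after \<open>a i\<close>: an idle robot stays put, and
        any later activation is still past \<open>T\<close> and so yields the same bound
        again.\<close>
      have "f (Suc t) i \<le> A - e / 2" if "a i \<le> t" for t
        using that
      proof (induction t rule: dec_induct)
        case base then show ?case using act[OF i] a[OF i] by blast
      next
        case (step t)
        then show ?case
          using act[of i "Suc t"] idle[of i "Suc t"] a[OF i] i by (cases "i \<in> S (Suc t)") auto
      qed
      moreover have "a i \<le> U" using i by (simp add: U_def)
      ultimately show ?thesis by blast
    qed
    then have "M (Suc U) \<le> A - e / 2" by (rule M_leI)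
    with A(2)[of "Suc U"] \<open>e > 0\<close> show False by linarith
  qed
  have "(\<lambda>t. f t i) \<longlonglongrightarrow> A" if "i < n" for i
    using B(1) A(1) unfolding \<open>A = B\<close>[symmetric]
    by (rule tendsto_sandwich[rotated 2]) (simp_all add: le_M m_le that)
  then show ?thesis by blast
qed

text \<open>One of the \<open>n\<close> terms equals the minimum, and the other \<open>n - 1\<close>
  are at most the maximum. This is the source of the factor \<open>1 / n\<close> in the
  contraction.\<close>

lemma average_le_Max_minus:
  fixes h :: "nat \<Rightarrow> real"
  assumes n: "1 \<le> n"
  shows "(\<Sum>i<n. h i) / n \<le> Max (h ` {..<n}) - (Max (h ` {..<n}) - Min (h ` {..<n})) / n"
proof -
  let ?M = "Max (h ` {..<n})" and ?m = "Min (h ` {..<n})"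
  have "?m \<in> h ` {..<n}" using n by (intro Min_in) (auto simp: lessThan_empty_iff)
  then obtain j where j: "j < n" "h j = ?m" by auto
  have "(\<Sum>i<n. h i) = h j + (\<Sum>i\<in>{..<n} - {j}. h i)"
    using j by (simp add: sum.remove)
  also have "(\<Sum>i\<in>{..<n} - {j}. h i) \<le> of_nat (card ({..<n} - {j})) * ?M"
    by (rule sum_bounded_above) auto
  finally have "(\<Sum>i<n. h i) \<le> ?m + (real n - 1) * ?M"
    using j n by (simp add: of_nat_diff)
  with n show ?thesis by (simp add: field_simps)
qed

text \<open>The preimage of an interval under a linear map is convex, so it contains the hull of any
  set it contains.\<close>

lemma linear_bounds_convex_hull:
  fixes L :: "'a::real_vector \<Rightarrow> real"
  assumes L: "linear L" and c: "c \<in> convex hull X" and X: "\<And>q. q \<in> X \<Longrightarrow> L q \<in> {l..r}"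
  shows "L c \<in> {l..r}"
proof -
  have "convex (L -` {l..r})"
    by (rule convex_linear_vimage[OF L]) simp
  with X have "convex hull X \<subseteq> L -` {l..r}" by (intro hull_minimal) auto
  with c show ?thesis by auto
qed

text \<open>The transpose inverts a rotation. Surjectivity makes \<open>inv\<close> a right inverse,
  so observed positions taken to local coordinates map back to the true ones.\<close>

lemma surj_local_to_global:
  assumes "0 < u" "rotation_matrix R"
  shows "surj (local_to_global u R p)"
proof (rule surjI)
  fix x
  have "R ** transpose R = mat 1"
    using assms by (simp add: rotation_matrix_def orthogonal_matrix_def)
  then have "R *v (transpose R *v w) = w" for w
    by (metis matrix_vector_mul_assoc matrix_vector_mul_lid)
  with assms(1) show "local_to_global u R p (transpose R *v ((1 / u) *\<^sub>R (x - p))) = x"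
    by (simp add: local_to_global_def del: transpose_matrix_vector)
qed

lemma linear_centroid:
  assumes "linear L"
  shows "L (centroid (image_mset q (mset_set {..<n}))) = (1 / real n) *\<^sub>R (\<Sum>i<n. L (q i))"
proof -
  have "sum_mset (image_mset q (mset_set {..<n})) = (\<Sum>i<n. q i)"
    by (simp only: sum_unfold_sum_mset)
  with assms show ?thesis by (simp add: centroid_def linear_scale linear_sum)
qed

text \<open>Since \<open>g\<close> is affine and \<open>d < 1\<close>, the global target is a convex
  combination of a hull point, with weight \<open>d\<close>, and the global centroid, with weight
  \<open>1 - d\<close>. Both have \<open>k\<close>-th coordinate in \<open>{m..M}\<close>, and that
  of the centroid is at least \<open>(M - m) / n\<close> below \<open>M\<close>.\<close>

lemma scaled_hull_coordinate_bounds: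
  fixes p :: "nat \<Rightarrow> point" and k :: 2
  assumes n: "1 \<le> n" and u: "0 < u" "rotation_matrix R"
    and g: "g = local_to_global u R o'"
    and d: "0 \<le> d" "d < b" "b < 1"
    and y: "y \<in> scaled_hull d (image_mset (inv g) (image_mset p (mset_set {..<n})))"
  defines "M \<equiv> Max ((\<lambda>i. p i $ k) ` {..<n})" and "m \<equiv> Min ((\<lambda>i. p i $ k) ` {..<n})"
  shows "m \<le> g y $ k" "g y $ k \<le> M - (1 - b) / n * (M - m)"
proof -
  \<comment> \<open>\<open>L\<close> is the linear part of the \<open>k\<close>-th coordinate of
    \<open>g\<close>. The offset \<open>o' $ k\<close> cancels from the formula for
    \<open>g y $ k\<close> because the weights sum to 1.\<close>
  define L where "L v = u * (R *v v) $ k" for v :: point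
  have L: "linear L"
    by (rule linearI) (simp_all add: L_def algebra_simps matrix_vector_right_distrib matrix_vector_mult_scaleR)
  have gL: "g v $ k = o' $ k + L v" for v by (simp add: g L_def local_to_global_def)
  have "g (inv g v) = v" for v
    unfolding g using surj_local_to_global[OF u] by (rule surj_f_inv_f)
  then have Lq: "L (inv g (p i)) = p i $ k - o' $ k" for i
    using gL[of "inv g (p i)"] by simp
  have bnd: "p i $ k \<in> {m..M}" if "i < n" for i
    using that by (auto simp: M_def m_def)
  define a where "a = (\<Sum>i<n. p i $ k) / n"
  obtain c where c: "c \<in> convex hull ((\<lambda>i. inv g (p i)) ` {..<n})"
    and yc: "y = d *\<^sub>R c + (1 - d) *\<^sub>R centroid (image_mset (\<lambda>i. inv g (p i)) (mset_set {..<n}))"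
    using y by (auto simp: scaled_hull_def image_mset.compositionality o_def image_image)
  have "L c \<in> {m - o' $ k..M - o' $ k}"
    using bnd by (intro linear_bounds_convex_hull[OF L c]) (auto simp: Lq)
  then have cb: "m \<le> g c $ k" "g c $ k \<le> M" by (auto simp: gL)
  have La: "L (centroid (image_mset (\<lambda>i. inv g (p i)) (mset_set {..<n}))) = a - o' $ k"
    using n unfolding linear_centroid[OF L] by (simp add: Lq a_def sum_subtractf field_simps)
  have gy: "g y $ k = d * g c $ k + (1 - d) * a"
    unfolding gL yc linear_add[OF L] linear_scale[OF L] La by (simp add: algebra_simps)
  have a_le: "a \<le> M - (M - m) / n"
    unfolding a_def M_def m_def by (rule average_le_Max_minus[OF n])
  have "real n * m \<le> (\<Sum>i<n. p i $ k)"
    using sum_bounded_below[of "{..<n}" m "\<lambda>i. p i $ k"] bnd by simp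
  then have m_a: "m \<le> a" using n by (simp add: a_def field_simps)
  have "d * m + (1 - d) * m \<le> d * g c $ k + (1 - d) * a"
    using d cb m_a by (intro add_mono mult_left_mono) auto
  then show "m \<le> g y $ k" by (simp add: gy algebra_simps)
  have "m \<le> M" using bnd[of 0] n by auto
  have "d * g c $ k + (1 - d) * a \<le> d * M + (1 - d) * (M - (M - m) / n)"
    using d cb a_le by (intro add_mono mult_left_mono) auto
  also have "\<dots> = M - (1 - d) * ((M - m) / n)" by (simp add: algebra_simps)
  \<comment> \<open>Passing from \<open>d\<close> to \<open>b\<close> makes the bound independent of
    the particular target.\<close>
  also have "\<dots> \<le> M - (1 - b) * ((M - m) / n)"
    using d \<open>m \<le> M\<close> by (intro diff_left_mono mult_right_mono) auto
  finally show "g y $ k \<le> M - (1 - b) / n * (M - m)" by (simp add: gy)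
qed

text \<open>The bound on the suprema passes to each \<phi> and \<open>P\<close>, and an infimum
  strictly below \<open>b\<close> has a witness below \<open>b\<close>.\<close>

lemma scale_set_lessD:
  assumes "scale_set \<Phi> < ereal b" "\<phi> \<in> \<Phi>" "P \<noteq> {#}" "\<phi> P = Some y"
  shows "\<exists>d. 0 \<le> d \<and> d < b \<and> y \<in> scaled_hull d P"
proof -
  have "scale_at \<phi> P \<le> scale \<phi>"
    unfolding scale_def using assms(3) by (intro SUP_upper) simp
  also have "scale \<phi> \<le> scale_set \<Phi>"
    unfolding scale_set_def using assms(2) by (rule SUP_upper)
  finally have "scale_at \<phi> P < ereal b" using assms(1) by (rule le_less_trans)
  then show ?thesis
    using assms(4) by (auto simp: scale_at_def Inf_less_iff)
qed

theorem theorem2: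
  fixes \<Phi> :: "target set"
  assumes "\<Phi> \<noteq> {}"
    and "\<And>\<phi>. \<phi> \<in> \<Phi> \<Longrightarrow> target_function \<phi>"
    and "0 \<le> scale_set \<Phi>" and "scale_set \<Phi> < 1"
  shows "compatible \<Phi> convergence"
  unfolding compatible_def
proof (intro allI impI)
  fix n :: nat and \<phi> u R S x
  assume n: "1 \<le> n" and \<phi>: "\<forall>i<n. \<phi> i \<in> \<Phi>"
    and u: "\<forall>i<n. 0 < u i \<and> rotation_matrix (R i)"
    and S: "fair_schedule n S" and ex: "execution n \<phi> u R S x"
  \<comment> \<open>A real \<open>b\<close> strictly between the scale and 1 gives one contraction
    constant for all robots, times and coordinates.\<close>
  obtain b where b: "scale_set \<Phi> < ereal b" "b < 1"
    using ereal_dense2[OF assms(4)] by auto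
  have idle: "x (Suc t) i = x t i" if "i < n" "i \<notin> S t" for t i
    using ex that by (simp add: execution_def Let_def)
  have move: "Min ((\<lambda>i. x t i $ k) ` {..<n}) \<le> x (Suc t) i $ k"
    "x (Suc t) i $ k \<le> Max ((\<lambda>i. x t i $ k) ` {..<n})
      - (1 - b) / n * (Max ((\<lambda>i. x t i $ k) ` {..<n}) - Min ((\<lambda>i. x t i $ k) ` {..<n}))"
    if i: "i < n" "i \<in> S t" for t i k
  proof -
    define g where "g = local_to_global (u i) (R i) (x t i)"
    define Q where "Q = image_mset (inv g) (image_mset (x t) (mset_set {..<n}))"
    have "map_option g (\<phi> i Q) = Some (x (Suc t) i)"
      using ex i unfolding execution_def Let_def Q_def g_def configuration_def by metis
    then obtain y where y: "\<phi> i Q = Some y" "x (Suc t) i = g y" by auto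
    have "Q \<noteq> {#}" using n by (auto simp: Q_def mset_set_empty_iff lessThan_empty_iff)
    then obtain d where d: "0 \<le> d" "d < b" "y \<in> scaled_hull d Q"
      using scale_set_lessD[OF b(1)] \<phi> i(1) y(1) by blast
    have "0 < u i" "rotation_matrix (R i)" using u i by auto
    from scaled_hull_coordinate_bounds[OF n this g_def d(1,2) b(2) d(3)[unfolded Q_def], of k]
    show "Min ((\<lambda>i. x t i $ k) ` {..<n}) \<le> x (Suc t) i $ k"
      "x (Suc t) i $ k \<le> Max ((\<lambda>i. x t i $ k) ` {..<n})
        - (1 - b) / n * (Max ((\<lambda>i. x t i $ k) ` {..<n}) - Min ((\<lambda>i. x t i $ k) ` {..<n}))"
      unfolding y(2) .
  qed
  \<comment> \<open>In each coordinate the limit is shared by all robots, so these limits assemble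
    into one common point.\<close>
  have "\<exists>l. \<forall>i<n. (\<lambda>t. x t i $ k) \<longlonglongrightarrow> l" for k
  proof (rule contracting_updates_converge[OF n, where c = "(1 - b) / n" and S = S])
    show "0 < (1 - b) / n" using b n by simp
    show "\<exists>\<^sub>\<infinity>t. i \<in> S t" if "i < n" for i
      using S that by (simp add: fair_schedule_def)
  qed (use idle move in auto)
  then obtain l where l: "\<And>k i. i < n \<Longrightarrow> (\<lambda>t. x t i $ k) \<longlonglongrightarrow> l k" by metis
  have "(\<lambda>t. x t i) \<longlonglongrightarrow> (\<chi> k. l k)" if "i < n" for i
    by (rule vec_tendstoI) (simp add: l[OF that])
  then show "convergence n x"
    unfolding convergence_def by blast
qed

end
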